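(* Let $X$ be a bounded lattice. In the ring $\mathbb{Z}^{\oplus X}$ (with product $x\cdot y=x\wedge y$ for $x,y\in X$) one has \[ J=\widetilde{J}+\langle 0_X\rangle, \] and consequently $\widetilde{V}(X)/\langle 0_X\rangle=M(X)$.
   Context: A bounded lattice $X$ has a least element $0_X$ and a greatest element $1_X$. $\mathbb{Z}^{\oplus X}$ is the free abelian group on the set $X$, made into a commutative ring with identity $1_X$ by extending $x\cdot y=x\wedge y$ bilinearly. $\widetilde{J}$ is the ideal of this ring generated by $\{x\vee y+x\wedge y-x-y : x,y\in X\}$, and $\widetilde{V}(X)=\mathbb{Z}^{\oplus X}/\widetilde{J}$. $J$ is the subgroup of $\mathbb{Z}^{\oplus X}$ generated (as an abelian group) by $0_X$ and all elements \[ x_1\vee\dots\vee x_k-\sum_{s=1}^k(-1)^{s+1}\sum_{1\leq i_1<\dots<i_s\leq k}x_{i_1}\wedge\dots\wedge x_{i_s},\qquad k\ge2,\ x_1,\dots,x_k\in X, \] and $M(X)=\mathbb{Z}^{\oplus X}/J$. $\langle 0_X\rangle$ denotes the ideal generated by the basis element $0_X$ (respectively by its class in $\widetilde{V}(X)$). *)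

theory Defs
  imports "HOL-Library.Poly_Mapping" "HOL-Algebra.QuotRing" "HOL-Algebra.Generated_Groups"
begin

text \<open>
  The bounded lattice \<open>X\<close> is a type of class \<open>bounded_lattice\<close>, with \<open>0\<^sub>X = Orderings.bot\<close> and
  \<open>1\<^sub>X = Orderings.top\<close>. No distributivity is assumed. The free abelian group on \<open>X\<close> is the type of finitely
  supported functions \<open>X \<Rightarrow>\<^sub>0 int\<close>, with basis elements \<open>frag_of x\<close>. The product below is the
  bilinear extension of the meet; the multiplication that \<open>Poly_Mapping\<close> itself defines on this
  type is a convolution with respect to addition of keys and plays no role here.
\<close>

definition meet_mult ::
    "('a::bounded_lattice \<Rightarrow>\<^sub>0 int) \<Rightarrow> ('a \<Rightarrow>\<^sub>0 int) \<Rightarrow> ('a \<Rightarrow>\<^sub>0 int)" where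
  "meet_mult f g = frag_extend (\<lambda>x. frag_extend (\<lambda>y. frag_of (Lattices.inf x y)) g) f"

definition lat_ring :: "('a::bounded_lattice \<Rightarrow>\<^sub>0 int) ring" where
  "lat_ring = \<lparr>carrier = UNIV, mult = meet_mult, one = frag_of Orderings.top, zero = 0, add = (+)\<rparr>"

lemma meet_mult_frag_of: "meet_mult (frag_of x) (frag_of y) = frag_of (Lattices.inf x y)"
  by (simp add: meet_mult_def)

lemma meet_mult_0_left: "meet_mult 0 g = 0"
  by (simp add: meet_mult_def)

lemma meet_mult_0_right: "meet_mult f 0 = 0"
  by (simp add: meet_mult_def frag_extend_eq_0)

lemma meet_mult_diff_left: "meet_mult (f - g) h = meet_mult f h - meet_mult g h"
  by (simp add: meet_mult_def frag_extend_diff)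

lemma frag_cmul_diff_right: "frag_cmul c (f - g) = frag_cmul c f - frag_cmul c g"
  by (rule poly_mapping_eqI) (simp add: lookup_minus algebra_simps)

lemma meet_mult_diff_right: "meet_mult h (f - g) = meet_mult h f - meet_mult h g"
  by (simp add: meet_mult_def frag_extend_diff)
    (simp add: frag_extend_def[of _ h] frag_cmul_diff_right sum_subtractf)

lemma meet_mult_add_left: "meet_mult (f + g) h = meet_mult f h + meet_mult g h"
  by (simp add: meet_mult_def frag_extend_add)

lemma frag_induct [case_names zero of diff]:
  assumes "P 0" "\<And>x. P (frag_of x)" "\<And>f g. P f \<Longrightarrow> P g \<Longrightarrow> P (f - g)"
  shows "P f"
  using frag_induction[of f UNIV P] assms by auto

lemmas meet_mult_linear =
  meet_mult_0_left meet_mult_0_right meet_mult_diff_left meet_mult_diff_right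

lemma meet_mult_commute: "meet_mult f g = meet_mult g f"
proof (induction f rule: frag_induct)
  case (of x)
  show ?case
    by (induction g rule: frag_induct)
      (simp_all add: meet_mult_linear meet_mult_frag_of Lattices.inf_commute)
qed (simp_all add: meet_mult_linear)

lemma meet_mult_assoc: "meet_mult (meet_mult f g) h = meet_mult f (meet_mult g h)"
proof (induction f rule: frag_induct)
  case (of x)
  show ?case
  proof (induction g rule: frag_induct)
    case (of y)
    show ?case
      by (induction h rule: frag_induct)
        (simp_all add: meet_mult_linear meet_mult_frag_of Lattices.inf_assoc)
  qed (simp_all add: meet_mult_linear)
qed (simp_all add: meet_mult_linear)

lemma meet_mult_top: "meet_mult (frag_of Orderings.top) f = f"
  by (induction f rule: frag_induct) (simp_all add: meet_mult_linear meet_mult_frag_of)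

lemma cring_lat_ring: "cring (lat_ring :: ('a::bounded_lattice \<Rightarrow>\<^sub>0 int) ring)"
proof (rule cringI)
  show "abelian_group (lat_ring :: ('a \<Rightarrow>\<^sub>0 int) ring)"
  proof (rule abelian_groupI)
    fix f :: "'a \<Rightarrow>\<^sub>0 int"
    show "\<exists>g\<in>carrier lat_ring. g \<oplus>\<^bsub>lat_ring\<^esub> f = \<zero>\<^bsub>lat_ring\<^esub>"
      by (rule bexI[of _ "- f"]) (simp_all add: lat_ring_def)
  qed (simp_all add: lat_ring_def ac_simps)
  show "comm_monoid (lat_ring :: ('a \<Rightarrow>\<^sub>0 int) ring)"
    by (rule comm_monoidI)
      (simp_all add: lat_ring_def meet_mult_assoc meet_mult_top,
        rule meet_mult_commute)
qed (simp_all add: lat_ring_def meet_mult_add_left)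

definition Jtilde :: "('a::bounded_lattice \<Rightarrow>\<^sub>0 int) set" where
  "Jtilde = genideal lat_ring
     {frag_of (Lattices.sup x y) + frag_of (Lattices.inf x y) - frag_of x - frag_of y | x y. True}"

definition Vtilde :: "('a::bounded_lattice \<Rightarrow>\<^sub>0 int) set ring" where
  "Vtilde = lat_ring Quot Jtilde"

text \<open>Index tuples \<open>1 \<le> i\<^sub>1 < \<dots> < i\<^sub>s \<le> k\<close> are encoded as \<open>s\<close>-element subsets of \<open>{1..k}\<close>.\<close>

definition incl_excl :: "nat \<Rightarrow> (nat \<Rightarrow> 'a::bounded_lattice) \<Rightarrow> ('a \<Rightarrow>\<^sub>0 int)" where
  "incl_excl k x =
     frag_of (Sup_fin (x ` {1..k})) -
     (\<Sum>s = 1..k. frag_cmul ((-1) ^ (s + 1))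
        (\<Sum>I \<in> {I. I \<subseteq> {1..k} \<and> card I = s}. frag_of (Inf_fin (x ` I))))"

definition Jsub :: "('a::bounded_lattice \<Rightarrow>\<^sub>0 int) set" where
  "Jsub = generate (add_monoid lat_ring)
     (insert (frag_of Orderings.bot) {incl_excl k x | k x. k \<ge> 2})"

definition Mgroup :: "('a::bounded_lattice \<Rightarrow>\<^sub>0 int) set monoid" where
  "Mgroup = lat_ring A_Mod Jsub"

text \<open>The ideal of the quotient ring \<open>Vtilde\<close> generated by the class of \<open>0\<^sub>X\<close>.\<close>

definition Vtilde_bot :: "('a::bounded_lattice \<Rightarrow>\<^sub>0 int) set set" where
  "Vtilde_bot = genideal Vtilde {Jtilde +>\<^bsub>lat_ring\<^esub> frag_of Orderings.bot}"

end

theory Submission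
  imports Defs
begin

text \<open>
  In the ring, \<open>1 - x\<^sub>1 \<or> \<dots> \<or> x\<^sub>k\<close> is to be compared with \<open>\<Prod>(1 - x\<^sub>i)\<close>, whose expansion is the alternating
  sum over meets. Hence the inclusion-exclusion elements \<open>D\<^sub>k\<close> satisfy
  \<open>D\<^sub>k\<^sub>+\<^sub>1 = r(x\<^sub>1 \<or> \<dots> \<or> x\<^sub>k, x\<^sub>k\<^sub>+\<^sub>1) + D\<^sub>k - x\<^sub>k\<^sub>+\<^sub>1 \<cdot> D\<^sub>k\<close>, where \<open>r(x, y) = x \<or> y + x \<and> y - x - y\<close>.
  Read from left to right this puts every \<open>D\<^sub>k\<close> into the ideal generated by the \<open>r(x, y)\<close>. Solved for
  \<open>x\<^sub>k\<^sub>+\<^sub>1 \<cdot> D\<^sub>k\<close>, with \<open>x\<^sub>k\<^sub>+\<^sub>1\<close> arbitrary, it shows that the subgroup generated by the \<open>D\<^sub>k\<close> is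
  closed under multiplication by the basis, even though the lattice need not be distributive.
\<close>

section \<open>Quotient rings and an iterated quotient\<close>

lemma zero_Quot: "\<zero>\<^bsub>R Quot I\<^esub> = I"
  by (simp add: FactRing_def)

lemma carrier_Quot: "carrier (R Quot I) = (\<lambda>x. I +>\<^bsub>R\<^esub> x) ` carrier R"
  by (auto simp: FactRing_def A_RCOSETS_def')

text \<open>This links quotient rings to \<open>Mgroup\<close>, which is defined only as a quotient
  of additive groups.\<close>

lemma add_monoid_Quot: "add_monoid (R Quot I) = R A_Mod I"
  by (simp add: FactRing_def A_FactGroup_def')

lemma (in abelian_subgroup) a_rcos_eq_self_iff:
  assumes "x \<in> carrier G"
  shows "H +> x = H \<longleftrightarrow> x \<in> H"
  using a_rcos_const[of x] a_rcos_self[OF assms] by auto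

text \<open>The composite of the two projections is onto, with kernel the sum of \<open>I\<close>
  and the ideal generated by \<open>S\<close>, so the first isomorphism theorem applies. The formula
  on classes is kept in the conclusion to record that the isomorphism is the canonical one.\<close>

lemma (in ring) quot_quot_iso:
  assumes I: "ideal I R" and S: "S \<subseteq> carrier R"
  shows "\<exists>h. h \<in> ring_iso ((R Quot I) Quot (genideal (R Quot I) ((+>) I ` S)))
                (R Quot (I <+>\<^bsub>R\<^esub> genideal R S)) \<and>
             (\<forall>x\<in>carrier R. h (genideal (R Quot I) ((+>) I ` S) +>\<^bsub>R Quot I\<^esub> (I +> x)) =
                (I <+>\<^bsub>R\<^esub> genideal R S) +> x)"
proof -
  define L where "L = genideal (R Quot I) ((+>) I ` S)"
  define K where "K = I <+>\<^bsub>R\<^esub> genideal R S"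
  define p where "p = (\<lambda>x. L +>\<^bsub>R Quot I\<^esub> (I +> x))"
  interpret I: ideal I R by (rule I)
  interpret Q: ring "R Quot I" by (rule I.quotient_is_ring)
  interpret q: ring_hom_ring R "R Quot I" "(+>) I" by (rule I.rcos_ring_hom_ring)
  have "(+>) I ` S \<subseteq> carrier (R Quot I)"
    using S q.hom_closed by blast
  then have L: "ideal L (R Quot I)" and SL: "(+>) I ` S \<subseteq> L"
    unfolding L_def by (rule Q.genideal_ideal, rule Q.genideal_self)
  interpret L: ideal L "R Quot I" by (rule L)
  have gS: "ideal (genideal R S) R" and SgS: "S \<subseteq> genideal R S"
    using S by (rule genideal_ideal, rule genideal_self)
  then have K: "ideal K R"
    unfolding K_def by (simp add: add_ideals I)
  interpret K: ideal K R by (rule K)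
  interpret gS: ideal "genideal R S" R by (rule gS)
  have IK: "I \<subseteq> K"
  proof
    fix x assume "x \<in> I"
    moreover from this have "x = x \<oplus> \<zero>" by simp
    ultimately show "x \<in> K" unfolding K_def set_add_def' using gS.zero_closed by blast
  qed
  have gSK: "genideal R S \<subseteq> K"
  proof
    fix x assume "x \<in> genideal R S"
    moreover from this have "x = \<zero> \<oplus> x" by simp
    ultimately show "x \<in> K" unfolding K_def set_add_def' using I.zero_closed by blast
  qed
  have "p \<in> ring_hom R ((R Quot I) Quot L)"
    using ring_hom_trans[OF I.rcos_ring_hom L.rcos_ring_hom] by (simp add: p_def comp_def)
  then have p: "ring_hom_ring R ((R Quot I) Quot L) p"
    by (rule ring_hom_ringI2[OF ring_axioms L.quotient_is_ring])
  have p_zero: "p x = \<zero>\<^bsub>(R Quot I) Quot L\<^esub> \<longleftrightarrow> I +> x \<in> L" if "x \<in> carrier R" for x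
    unfolding p_def zero_Quot by (rule L.a_rcos_eq_self_iff[OF q.hom_closed[OF that]])
  have mem_ker: "x \<in> a_kernel R ((R Quot I) Quot L) p \<longleftrightarrow> x \<in> carrier R \<and> I +> x \<in> L" for x
    unfolding a_kernel_def' using p_zero by blast
  have ker: "a_kernel R ((R Quot I) Quot L) p = K"
  proof
    show "a_kernel R ((R Quot I) Quot L) p \<subseteq> K"
    proof
      fix x assume "x \<in> a_kernel R ((R Quot I) Quot L) p"
      then have x: "x \<in> carrier R" "I +> x \<in> L"
        unfolding mem_ker by blast+
      \<comment> \<open>The image of \<open>K\<close> is an ideal of the quotient by
        \<open>I\<close> and contains the generators of \<open>L\<close>.\<close>
      have "L \<subseteq> (+>) I ` K"
        unfolding L_def
        by (rule Q.genideal_minimal[OF ring_ideal_imp_quot_ideal[OF I K]])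
          (use SgS gSK in blast)
      with x obtain y where y: "y \<in> K" "I +> x = I +> y" by blast
      then have "x \<in> I +> y" using x(1) I.a_rcos_self by blast
      then obtain i where "i \<in> I" "x = i \<oplus> y"
        unfolding a_r_coset_def' by blast
      then show "x \<in> K" using IK y(1) by blast
    qed
    have *: "ideal (a_kernel R ((R Quot I) Quot L) p) R"
      by (rule ring_hom_ring.kernel_is_ideal[OF p])
    have "S \<subseteq> a_kernel R ((R Quot I) Quot L) p"
      using S SL mem_ker by blast
    then have 1: "genideal R S \<subseteq> a_kernel R ((R Quot I) Quot L) p"
      by (rule genideal_minimal[OF *])
    have 2: "I \<subseteq> a_kernel R ((R Quot I) Quot L) p"
    proof
      fix x assume x: "x \<in> I"
      then have "I +> x = I" using I.a_rcos_const by blast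
      moreover have "I \<in> L" using L.zero_closed by (simp only: zero_Quot)
      ultimately show "x \<in> a_kernel R ((R Quot I) Quot L) p"
        using I.Icarr[OF x] by (simp only: mem_ker)
    qed
    show "K \<subseteq> a_kernel R ((R Quot I) Quot L) p"
      using 1 2 additive_subgroup.a_closed[OF ideal.axioms(1)[OF *]]
      unfolding K_def set_add_def' by blast
  qed
  have surj: "p ` carrier R = carrier ((R Quot I) Quot L)"
    unfolding p_def carrier_Quot image_image ..
  \<comment> \<open>The first isomorphism theorem yields a map out of \<open>R Quot K\<close>; the
    isomorphism sought is its inverse.\<close>
  define g where "g = (\<lambda>X. the_elem (p ` X))"
  have g: "g \<in> ring_iso (R Quot K) ((R Quot I) Quot L)"
    using ring_hom_ring.FactRing_iso_set[OF p surj] by (simp add: ker g_def)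
  have gx: "g (K +> x) = p x" if "x \<in> carrier R" for x
    using ring_hom_ring.the_elem_simp[OF p that] by (simp add: ker g_def)
  have inj: "inj_on g (carrier (R Quot K))"
    using g by (simp add: ring_iso_def bij_betw_def)
  have carr: "K +> x \<in> carrier (R Quot K)" if "x \<in> carrier R" for x
    using that K.rcos_ring_hom by (rule ring_hom_closed[rotated])
  have "inv_into (carrier (R Quot K)) g (p x) = K +> x" if "x \<in> carrier R" for x
    using inv_into_f_f[OF inj carr[OF that]] gx[OF that] by simp
  moreover have "inv_into (carrier (R Quot K)) g \<in> ring_iso ((R Quot I) Quot L) (R Quot K)"
    by (rule ring_iso_set_sym[OF K.quotient_is_ring g])
  ultimately show ?thesis
    unfolding p_def L_def[symmetric] K_def[symmetric] by blast
qed

lemma ring_iso_imp_add_iso: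
  assumes "h \<in> ring_iso R S"
  shows "h \<in> iso (add_monoid R) (add_monoid S)"
  using assms by (auto simp: ring_iso_def ring_hom_def iso_def hom_def)

section \<open>Linearity of the product and the inclusion-exclusion recursion\<close>

lemma lat_ring_simps [simp]:
  "carrier lat_ring = UNIV" "mult lat_ring = meet_mult" "\<one>\<^bsub>lat_ring\<^esub> = frag_of Orderings.top"
  "\<zero>\<^bsub>lat_ring\<^esub> = 0" "add lat_ring = (+)"
  by (simp_all add: lat_ring_def)

lemma meet_mult_add_right: "meet_mult h (f + g) = meet_mult h f + meet_mult h g"
  using meet_mult_add_left[of f g h] by (simp add: meet_mult_commute)

lemma meet_mult_uminus_right: "meet_mult h (- f) = - meet_mult h f"
  using meet_mult_diff_right[of h 0 f] by (simp add: meet_mult_0_right)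

lemma meet_mult_sum_right: "meet_mult h (\<Sum>i\<in>A. f i) = (\<Sum>i\<in>A. meet_mult h (f i))"
  by (induction A rule: infinite_finite_induct)
    (simp_all add: meet_mult_0_right meet_mult_add_right)

lemma meet_mult_cmul_right: "meet_mult h (frag_cmul c f) = frag_cmul c (meet_mult h f)"
  unfolding meet_mult_commute[of h] by (simp add: meet_mult_def frag_extend_cmul)

text \<open>Adjoining \<open>top\<close> gives the empty meet its value \<open>1\<^sub>X\<close>; on \<open>{}\<close> alone \<open>Inf_fin\<close> is unspecified.\<close>

definition meet_expansion :: "nat \<Rightarrow> (nat \<Rightarrow> 'a::bounded_lattice) \<Rightarrow> ('a \<Rightarrow>\<^sub>0 int)" where
  "meet_expansion k x =
     (\<Sum>I\<in>Pow {1..k}. frag_cmul ((-1) ^ card I) (frag_of (Inf_fin (insert Orderings.top (x ` I)))))"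

text \<open>The expansion is the product of the factors \<open>1 - x i\<close>, and this splits off
  the last one: the subsets without \<open>Suc k\<close> give the first term, those with it the
  second, the sign coming from the extra element.\<close>

lemma meet_expansion_Suc:
  "meet_expansion (Suc k) x =
     meet_expansion k x - meet_mult (frag_of (x (Suc k))) (meet_expansion k x)"
proof -
  let ?m = "\<lambda>I. Inf_fin (insert Orderings.top (x ` I))"
  let ?t = "\<lambda>I. frag_cmul ((-1) ^ card I) (frag_of (?m I))"
  have m: "?m (insert (Suc k) I) = Lattices.inf (x (Suc k)) (?m I)" if "finite I" for I
    using that by (simp add: insert_commute[of Orderings.top])
  have "meet_expansion (Suc k) x = (\<Sum>I\<in>Pow {1..k} \<union> insert (Suc k) ` Pow {1..k}. ?t I)"
    unfolding meet_expansion_def by (simp add: atLeastAtMostSuc_conv Pow_insert)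
  also have "\<dots> = meet_expansion k x + (\<Sum>I\<in>insert (Suc k) ` Pow {1..k}. ?t I)"
    unfolding meet_expansion_def by (rule sum.union_disjoint) auto
  also have "(\<Sum>I\<in>insert (Suc k) ` Pow {1..k}. ?t I) = (\<Sum>I\<in>Pow {1..k}. ?t (insert (Suc k) I))"
  proof -
    have "inj_on (insert (Suc k)) (Pow {1..k})"
      by (rule inj_onI) (metis Diff_insert_absorb PowD atLeastAtMost_iff not_less_eq_eq order_refl subsetD)
    from sum.reindex[OF this, of ?t] show ?thesis by (simp only: comp_def)
  qed
  also have "\<dots> = (\<Sum>I\<in>Pow {1..k}. - meet_mult (frag_of (x (Suc k))) (?t I))"
  proof (rule sum.cong[OF refl])
    fix I assume "I \<in> Pow {1..k}"
    then have I: "finite I" "Suc k \<notin> I"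
      by (auto intro: finite_subset)
    then show "?t (insert (Suc k) I) = - meet_mult (frag_of (x (Suc k))) (?t I)"
      unfolding m[OF I(1)] by (simp add: meet_mult_cmul_right meet_mult_frag_of)
  qed
  also have "\<dots> = - meet_mult (frag_of (x (Suc k))) (meet_expansion k x)"
    unfolding meet_expansion_def meet_mult_sum_right sum_negf ..
  finally show ?thesis by simp
qed

text \<open>Grouping nonempty index sets by cardinality turns the double sum into one sum over
  subsets; the term \<open>frag_of top\<close> accounts for the empty set.\<close>

lemma incl_excl_conv_meet_expansion:
  "incl_excl k x = frag_of (Sup_fin (x ` {1..k})) - frag_of Orderings.top + meet_expansion k x"
proof -
  let ?t = "\<lambda>I. frag_cmul ((-1) ^ card I) (frag_of (Inf_fin (insert Orderings.top (x ` I))))"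
  let ?A = "Pow {1..k} - {{}}"
  have "(\<Sum>s = 1..k. frag_cmul ((-1) ^ (s + 1))
          (\<Sum>I \<in> {I. I \<subseteq> {1..k} \<and> card I = s}. frag_of (Inf_fin (x ` I)))) =
        (\<Sum>s = 1..k. \<Sum>I \<in> {I. I \<in> ?A \<and> card I = s}. - ?t I)"
  proof (rule sum.cong[OF refl])
    fix s assume s: "s \<in> {1..k}"
    have eq: "{I. I \<subseteq> {1..k} \<and> card I = s} = {I. I \<in> ?A \<and> card I = s}"
      using s by auto
    have "frag_cmul ((-1) ^ (s + 1)) (frag_of (Inf_fin (x ` I))) = - ?t I"
      if "I \<in> ?A" "card I = s" for I
    proof -
      \<comment> \<open>For nonempty \<open>I\<close> the adjoined \<open>top\<close> does not
        change the meet.\<close>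
      have "finite I" "I \<noteq> {}" using that by (auto intro: finite_subset)
      then show ?thesis using that by simp
    qed
    then show "frag_cmul ((-1) ^ (s + 1))
          (\<Sum>I \<in> {I. I \<subseteq> {1..k} \<and> card I = s}. frag_of (Inf_fin (x ` I))) =
        (\<Sum>I \<in> {I. I \<in> ?A \<and> card I = s}. - ?t I)"
      unfolding eq frag_cmul_sum by (intro sum.cong) auto
  qed
  also have "\<dots> = (\<Sum>I\<in>?A. - ?t I)"
  proof (rule sum.group)
    show "card ` ?A \<subseteq> {1..k}"
    proof (rule image_subsetI)
      fix I assume "I \<in> ?A"
      then have I: "I \<subseteq> {1..k}" "I \<noteq> {}" by auto
      then have "finite I" by (auto intro: finite_subset)
      with I card_mono[OF _ I(1)] show "card I \<in> {1..k}"
        by (simp add: Suc_le_eq card_gt_0_iff)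
    qed
  qed auto
  also have "\<dots> = frag_of Orderings.top - meet_expansion k x"
    unfolding meet_expansion_def sum_negf by (simp add: sum_diff1)
  finally show ?thesis unfolding incl_excl_def by simp
qed

definition modular_rel :: "'a::bounded_lattice \<Rightarrow> 'a \<Rightarrow> ('a \<Rightarrow>\<^sub>0 int)" where
  "modular_rel x y =
     frag_of (Lattices.sup x y) + frag_of (Lattices.inf x y) - frag_of x - frag_of y"

text \<open>With \<open>s\<close> the join of the first \<open>k\<close> elements, the product of
  \<open>x (Suc k)\<close> with \<open>s\<close> is the meet occurring in
  \<open>modular_rel\<close>, and its product with \<open>top\<close> is \<open>x (Suc k)\<close>
  itself. For \<open>k = 0\<close> the join would be an unspecified
  \<open>Sup_fin {}\<close>.\<close>

lemma incl_excl_Suc: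
  assumes "k \<ge> 1"
  shows "incl_excl (Suc k) x =
    modular_rel (Sup_fin (x ` {1..k})) (x (Suc k)) + incl_excl k x
      - meet_mult (frag_of (x (Suc k))) (incl_excl k x)"
proof -
  have "Sup_fin (x ` {1..Suc k}) = Lattices.sup (x (Suc k)) (Sup_fin (x ` {1..k}))"
    using assms by (simp add: atLeastAtMostSuc_conv)
  moreover have "meet_mult (frag_of (x (Suc k))) (frag_of Orderings.top) = frag_of (x (Suc k))"
    by (simp add: meet_mult_frag_of)
  ultimately show ?thesis
    by (simp add: incl_excl_conv_meet_expansion meet_expansion_Suc modular_rel_def
        meet_mult_add_right meet_mult_diff_right meet_mult_frag_of
        Lattices.sup_commute Lattices.inf_commute algebra_simps)
qed

lemma incl_excl_1: "incl_excl 1 x = 0"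
proof -
  have "meet_expansion 0 x = frag_of Orderings.top"
    by (simp add: meet_expansion_def)
  then show ?thesis
    using meet_expansion_Suc[of 0 x]
    by (simp add: incl_excl_conv_meet_expansion meet_mult_frag_of)
qed

text \<open>This identifies the generators of \<open>Jtilde\<close> among those of
  \<open>Jsub\<close>.\<close>

lemma incl_excl_2: "incl_excl 2 x = modular_rel (x 1) (x 2)"
  using incl_excl_Suc[of 1 x] by (simp add: incl_excl_1[simplified] meet_mult_0_right numeral_2_eq_2)

lemma incl_excl_cong:
  assumes "\<And>i. i \<in> {1..k} \<Longrightarrow> x i = y i"
  shows "incl_excl k x = incl_excl k y"
proof -
  have "x ` I = y ` I" if "I \<subseteq> {1..k}" for I
    using assms that by (intro image_cong) auto
  then show ?thesis
    unfolding incl_excl_def by simp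
qed

section \<open>Closure of \<open>Jsub\<close> under multiplication\<close>

interpretation lat: cring lat_ring
  by (rule cring_lat_ring)

lemma lat_ring_minus: "a_inv lat_ring f = - f"
  by (rule lat.minus_equality) simp_all

lemma lat_ring_add_inv: "inv\<^bsub>add_monoid lat_ring\<^esub> f = - f"
  using lat_ring_minus by (simp only: a_inv_def)

lemma Jsub_subgroup: "subgroup Jsub (add_monoid lat_ring)"
  unfolding Jsub_def by (rule lat.add.generate_is_subgroup) simp

lemma Jsub_closed:
  shows "0 \<in> Jsub" and "f \<in> Jsub \<Longrightarrow> g \<in> Jsub \<Longrightarrow> f + g \<in> Jsub"
    and "f \<in> Jsub \<Longrightarrow> - f \<in> Jsub"
  using subgroup.one_closed[OF Jsub_subgroup] subgroup.m_closed[OF Jsub_subgroup, of f g]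
    subgroup.m_inv_closed[OF Jsub_subgroup, of f]
  unfolding lat_ring_add_inv by simp_all

lemma Jsub_diff_closed: "f \<in> Jsub \<Longrightarrow> g \<in> Jsub \<Longrightarrow> f - g \<in> Jsub"
  using Jsub_closed(2)[of f "- g"] Jsub_closed(3)[of g] by simp

lemma bot_in_Jsub: "frag_of Orderings.bot \<in> Jsub"
  unfolding Jsub_def by (rule generate.incl) simp

lemma incl_excl_in_Jsub: "k \<ge> 2 \<Longrightarrow> incl_excl k x \<in> Jsub"
  unfolding Jsub_def by (rule generate.incl) blast

lemma modular_rel_in_Jsub: "modular_rel x y \<in> Jsub"
  using incl_excl_in_Jsub[of 2 "\<lambda>i. if i = 1 then x else y"] by (simp add: incl_excl_2)

text \<open>The recursion solved for its product term: all remaining terms are generators of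
  \<open>Jsub\<close>.\<close>

lemma meet_mult_incl_excl_in_Jsub:
  assumes "k \<ge> 2"
  shows "meet_mult (frag_of a) (incl_excl k x) \<in> Jsub"
proof -
  \<comment> \<open>\<open>incl_excl k\<close> reads only the indices \<open>1\<close> to
    \<open>k\<close>, so the entry at \<open>Suc k\<close> is free to be \<open>a\<close>.\<close>
  define y where "y = x(Suc k := a)"
  have "incl_excl k x = incl_excl k y"
    by (rule incl_excl_cong) (auto simp: y_def)
  moreover have "meet_mult (frag_of a) (incl_excl k y) =
      modular_rel (Sup_fin (y ` {1..k})) (y (Suc k)) + incl_excl k y - incl_excl (Suc k) y"
    using incl_excl_Suc[of k y] assms by (simp add: y_def)
  moreover have "\<dots> \<in> Jsub"
    using assms by (intro Jsub_closed Jsub_diff_closed modular_rel_in_Jsub incl_excl_in_Jsub) simp_all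
  ultimately show ?thesis by simp
qed

text \<open>Multiplication by \<open>frag_of a\<close> is additive, so the generators decide;
  \<open>frag_of bot\<close> is mapped to itself because \<open>bot\<close> absorbs meets.\<close>

lemma meet_mult_basis_in_Jsub:
  assumes "f \<in> Jsub"
  shows "meet_mult (frag_of a) f \<in> Jsub"
proof -
  let ?S = "insert (frag_of Orderings.bot) {incl_excl k x | k x. k \<ge> 2}"
  have gen: "meet_mult (frag_of a) f \<in> Jsub" if "f \<in> ?S" for f
    using that meet_mult_incl_excl_in_Jsub bot_in_Jsub by (auto simp: meet_mult_frag_of)
  show ?thesis
    using assms unfolding Jsub_def
  proof (induction f rule: generate.induct)
    case one
    show ?case using Jsub_closed(1) by (simp add: meet_mult_0_right Jsub_def)
  next
    case (incl f)
    then show ?case using gen by (simp add: Jsub_def)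
  next
    case (inv f)
    then show ?case using Jsub_closed(3)[OF gen[OF inv]]
      unfolding lat_ring_add_inv by (simp add: meet_mult_uminus_right Jsub_def)
  next
    case (eng f g)
    then show ?case using Jsub_closed(2)
      by (simp add: meet_mult_add_right Jsub_def)
  qed
qed

lemma meet_mult_in_Jsub:
  assumes "f \<in> Jsub"
  shows "meet_mult g f \<in> Jsub"
  by (induction g rule: frag_induct)
    (simp_all add: meet_mult_0_left Jsub_closed meet_mult_basis_in_Jsub assms
      meet_mult_diff_left Jsub_diff_closed)

lemma ideal_Jsub: "ideal (Jsub :: ('a::bounded_lattice \<Rightarrow>\<^sub>0 int) set) lat_ring"
proof (rule idealI[OF lat.ring_axioms Jsub_subgroup])
  fix f g :: "'a \<Rightarrow>\<^sub>0 int" assume "f \<in> Jsub"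
  then show "g \<otimes>\<^bsub>lat_ring\<^esub> f \<in> Jsub" "f \<otimes>\<^bsub>lat_ring\<^esub> g \<in> Jsub"
    using meet_mult_in_Jsub[of f g] by (simp_all add: meet_mult_commute[of f g])
qed

section \<open>Comparison with \<open>Jtilde\<close> and the quotients\<close>

lemma ideal_Jtilde: "ideal Jtilde lat_ring"
  unfolding Jtilde_def by (rule lat.genideal_ideal) simp

lemma modular_rel_in_Jtilde: "modular_rel x y \<in> Jtilde"
  unfolding Jtilde_def modular_rel_def by (rule subsetD[OF lat.genideal_self]) auto

text \<open>The induction starts at \<open>k = 1\<close>, where the element is zero; each step of
  the recursion stays inside an ideal containing the modular relations.\<close>

lemma incl_excl_in_Jtilde:
  assumes "k \<ge> 1"
  shows "incl_excl k x \<in> Jtilde"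
  using assms
proof (induction k rule: dec_induct)
  case base
  show ?case
    using additive_subgroup.zero_closed[OF ideal.axioms(1)[OF ideal_Jtilde]]
    by (simp add: incl_excl_1[simplified])
next
  case (step k)
  interpret ideal Jtilde lat_ring by (rule ideal_Jtilde)
  have "meet_mult (frag_of (x (Suc k))) (incl_excl k x) \<in> Jtilde"
    using I_l_closed[OF step.IH] by simp
  then have "- meet_mult (frag_of (x (Suc k))) (incl_excl k x) \<in> Jtilde"
    using a_inv_closed by (fastforce simp: lat_ring_minus)
  from a_closed[OF a_closed[OF modular_rel_in_Jtilde step.IH] this]
  show ?case using step.hyps by (simp add: incl_excl_Suc)
qed

text \<open>Each inclusion is checked on generators: the right side is a subgroup containing those
  of \<open>Jsub\<close>, and \<open>Jsub\<close> is an ideal containing those of both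
  summands.\<close>

lemma Jsub_eq:
  "Jsub = Jtilde <+>\<^bsub>lat_ring\<^esub> genideal lat_ring {frag_of Orderings.bot}" (is "_ = _ <+>\<^bsub>_\<^esub> ?B")
proof
  interpret T: ideal Jtilde lat_ring by (rule ideal_Jtilde)
  have B: "ideal ?B lat_ring" by (rule lat.genideal_ideal) simp
  interpret B: ideal ?B lat_ring by (rule B)
  interpret TB: ideal "Jtilde <+>\<^bsub>lat_ring\<^esub> ?B" lat_ring
    by (rule lat.add_ideals[OF ideal_Jtilde B])
  have "frag_of Orderings.bot \<in> ?B"
    by (rule lat.genideal_self') simp
  then have bot: "frag_of Orderings.bot \<in> Jtilde <+>\<^bsub>lat_ring\<^esub> ?B"
    using T.zero_closed by (force simp: set_add_def')
  have "Jtilde \<subseteq> Jtilde <+>\<^bsub>lat_ring\<^esub> ?B"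
    using B.zero_closed by (force simp: set_add_def')
  with bot have "insert (frag_of Orderings.bot) {incl_excl k x | k x. k \<ge> 2} \<subseteq> Jtilde <+>\<^bsub>lat_ring\<^esub> ?B"
    using incl_excl_in_Jtilde[OF order_trans[OF one_le_numeral]] by blast
  then show "Jsub \<subseteq> Jtilde <+>\<^bsub>lat_ring\<^esub> ?B"
    unfolding Jsub_def by (rule lat.add.generate_subgroup_incl) (rule TB.a_subgroup)
  have "Jtilde \<subseteq> Jsub"
    unfolding Jtilde_def
    by (rule lat.genideal_minimal[OF ideal_Jsub])
      (use modular_rel_in_Jsub in \<open>auto simp: modular_rel_def\<close>)
  moreover have "?B \<subseteq> Jsub"
    by (rule lat.genideal_minimal[OF ideal_Jsub]) (simp add: bot_in_Jsub)
  ultimately show "Jtilde <+>\<^bsub>lat_ring\<^esub> ?B \<subseteq> Jsub"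
    by (auto simp: set_add_def' intro!: Jsub_closed)
qed

text \<open>The equality of quotients is read as the canonical isomorphism: the formula on classes
  determines \<open>h\<close> on the whole carrier. Since \<open>Jsub\<close> is an ideal, the
  additive group \<open>Mgroup\<close> underlies the ring \<open>lat_ring Quot Jsub\<close>, and
  \<open>h\<close> respects both structures.\<close>

theorem mainTheorem8:
  shows "(Jsub :: ('a::bounded_lattice \<Rightarrow>\<^sub>0 int) set) =
           Jtilde <+>\<^bsub>lat_ring\<^esub> genideal lat_ring {frag_of Orderings.bot} \<and>
         ideal (Jsub :: ('a \<Rightarrow>\<^sub>0 int) set) lat_ring \<and>
         (\<exists>h :: ('a \<Rightarrow>\<^sub>0 int) set set \<Rightarrow> ('a \<Rightarrow>\<^sub>0 int) set.
            h \<in> iso (add_monoid (Vtilde Quot Vtilde_bot)) Mgroup \<and>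
            h \<in> ring_iso (Vtilde Quot Vtilde_bot) (lat_ring Quot Jsub) \<and>
            (\<forall>f. h (Vtilde_bot +>\<^bsub>Vtilde\<^esub> (Jtilde +>\<^bsub>lat_ring\<^esub> f)) = Jsub +>\<^bsub>lat_ring\<^esub> f))"
proof -
  obtain h :: "('a \<Rightarrow>\<^sub>0 int) set set \<Rightarrow> ('a \<Rightarrow>\<^sub>0 int) set"
    where h: "h \<in> ring_iso (Vtilde Quot Vtilde_bot) (lat_ring Quot Jsub)"
      and hf: "\<forall>f. h (Vtilde_bot +>\<^bsub>Vtilde\<^esub> (Jtilde +>\<^bsub>lat_ring\<^esub> f)) = Jsub +>\<^bsub>lat_ring\<^esub> f"
    using lat.quot_quot_iso[OF ideal_Jtilde, of "{frag_of Orderings.bot}"]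
    by (auto simp: Vtilde_def Vtilde_bot_def Jsub_eq)
  have "h \<in> iso (add_monoid (Vtilde Quot Vtilde_bot)) Mgroup"
    using ring_iso_imp_add_iso[OF h] unfolding add_monoid_Quot[of lat_ring] Mgroup_def .
  with h hf show ?thesis
    using Jsub_eq ideal_Jsub by blast
qed

end
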